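(* Let $k = 2j$ for a positive integer $j$. Then there is a graph $G$ with $|V(G)| = 2^{k-1} + k - 2$ and $\textrm{RED:LD}(G) = k$.
   Context: $N(v)$ denotes the open neighborhood of $v$. A set $S \subseteq V(G)$ is a locating-dominating (LD) set if for all $u,v \in V(G)-S$: $N(v)\cap S \neq \varnothing$, and if $u \ne v$ then $N(v) \cap S \neq N(u) \cap S$. A RED:LD set is an LD set $S$ such that $S-\{v\}$ is an LD set for every $v \in S$. $\textrm{RED:LD}(G)$ denotes the minimum cardinality of a RED:LD set of $G$. *)

theory Defs
  imports "Graph_Theory.Pair_Digraph" "HOL-Library.Extended_Nat"
begin

text \<open>
  A finite simple graph is a \<^locale>\<open>pair_graph\<close>: a finite, loop-free, symmetric digraph whose
  arcs are ordered pairs of vertices, each edge being represented by its two arcs.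
\<close>

definition open_nbhd :: "'a pair_pre_digraph \<Rightarrow> 'a \<Rightarrow> 'a set" where
  "open_nbhd G v = {u \<in> pverts G. (v, u) \<in> parcs G}"

definition LD_set :: "'a pair_pre_digraph \<Rightarrow> 'a set \<Rightarrow> bool" where
  "LD_set G S \<longleftrightarrow> S \<subseteq> pverts G \<and>
     (\<forall>u \<in> pverts G - S. \<forall>v \<in> pverts G - S.
        open_nbhd G v \<inter> S \<noteq> {} \<and>
        (u \<noteq> v \<longrightarrow> open_nbhd G v \<inter> S \<noteq> open_nbhd G u \<inter> S))"

definition RED_LD_set :: "'a pair_pre_digraph \<Rightarrow> 'a set \<Rightarrow> bool" where
  "RED_LD_set G S \<longleftrightarrow> LD_set G S \<and> (\<forall>v \<in> S. LD_set G (S - {v}))"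

text \<open>
  Not every graph has a RED:LD set (one with an isolated vertex does not). Taking the infimum in
  \<^typ>\<open>enat\<close> gives the value \<open>\<infinity>\<close> in that case, so that a finite value
  always means that a RED:LD set of this minimum cardinality exists.
\<close>

definition RED_LD :: "'a pair_pre_digraph \<Rightarrow> enat" where
  "RED_LD G = (INF S \<in> {S. RED_LD_set G S}. enat (card S))"

end

theory Submission
  imports Defs
begin

text \<open>
  Deleting a vertex \<open>v\<close> from a RED:LD set \<open>S\<close> leaves an LD set, so the traces on \<open>S - {v}\<close> of
  the vertices outside it are distinct nonempty sets. Hence a graph with a RED:LD set of size
  \<open>m\<close> has at most \<open>2 ^ (m - 1) + m - 2\<close> vertices. For even \<open>k\<close> the bound is attained by a
  \<open>k\<close>-clique together with one vertex for every nonempty proper subset of the clique of even size,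
  adjacent to exactly that subset: distinct even sets differ in at least two elements, and a clique
  vertex \<open>v\<close> could be confused, once it is deleted from the detectors, only with a vertex whose
  trace is the whole clique or the clique without \<open>v\<close>; the former is excluded, the latter has odd size.
\<close>

lemma LD_set_card_bound:
  assumes "finite (pverts G)" and "LD_set G S"
  shows "card (pverts G) + 1 \<le> 2 ^ card S + card S"
proof -
  let ?tr = "\<lambda>u. open_nbhd G u \<inter> S"
  have sub: "S \<subseteq> pverts G" and fin: "finite S"
    using assms finite_subset unfolding LD_set_def by auto
  have "inj_on ?tr (pverts G - S)"
    using assms(2) unfolding LD_set_def inj_on_def by blast
  moreover have "?tr ` (pverts G - S) \<subseteq> Pow S - {{}}"
    using assms(2) unfolding LD_set_def by blast
  ultimately have "card (pverts G - S) \<le> card (Pow S - {{}})"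
    using fin by (intro card_inj_on_le) auto
  also have "\<dots> = 2 ^ card S - 1"
    using fin by (simp add: card_Pow)
  finally have "card (pverts G) - card S \<le> 2 ^ card S - 1"
    using fin sub by (simp add: card_Diff_subset)
  moreover have "(1::nat) \<le> 2 ^ card S" by simp
  ultimately show ?thesis by linarith
qed

text \<open>A vertex to delete must exist: with \<open>S = {}\<close> any vertex of the graph would
  have an empty trace. In the empty graph \<open>{}\<close> is a RED:LD set and the bound would read
  2 \<le> 1.\<close>

lemma RED_LD_set_card_bound:
  assumes "finite (pverts G)" and "pverts G \<noteq> {}" and "RED_LD_set G S"
  shows "card (pverts G) + 2 \<le> 2 ^ (card S - 1) + card S"
proof -
  have ld: "LD_set G S" using assms(3) by (simp add: RED_LD_set_def)
  then have ne: "S \<noteq> {}" using assms(2) by (auto simp: LD_set_def)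
  then obtain v where v: "v \<in> S" by blast
  have "finite S" using ld assms(1) finite_subset by (auto simp: LD_set_def)
  then have "card (S - {v}) = card S - 1" and "card S \<ge> 1"
    using v ne by (simp_all add: card_gt_0_iff Suc_leI)
  moreover have "LD_set G (S - {v})" using assms(3) v by (simp add: RED_LD_set_def)
  ultimately show ?thesis
    using LD_set_card_bound[OF assms(1), of "S - {v}"] by simp
qed

lemma card_even_subsets:
  assumes "finite A" and "A \<noteq> {}"
  shows "card {B. B \<subseteq> A \<and> even (card B)} = 2 ^ (card A - 1)"
proof -
  let ?E = "{B. B \<subseteq> A \<and> even (card B)}" and ?O = "{B. B \<subseteq> A \<and> odd (card B)}"
  have "Pow A = ?E \<union> ?O" "?E \<inter> ?O = {}" by auto
  moreover have "finite ?E" "finite ?O" using assms(1) by simp_all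
  ultimately have "card (Pow A) = card ?E + card ?O"
    by (metis card_Un_disjoint)
  \<comment> \<open>The library lemma balances the even and odd sets between a proper subset of
    \<open>A\<close> and \<open>A\<close>; here the lower set is \<open>{}\<close>, proper since
    \<open>A\<close> is nonempty.\<close>
  moreover have "card ?E = card ?O"
    using card_subsupersets_even_odd[of A "{}"] assms by (simp add: psubset_eq)
  moreover have "(2::nat) ^ card A = 2 * 2 ^ (card A - 1)"
    using assms by (metis card_gt_0_iff power_minus_mult mult.commute)
  ultimately show ?thesis using assms(1) by (simp add: card_Pow)
qed

text \<open>The common remainder has one cardinality, and its parity alone decides whether
  \<open>v\<close> must be added back to reach an even set.\<close>

lemma even_card_eq_if_Diff_eq:
  assumes "finite A" and "finite B" and "even (card A)" and "even (card B)"
    and "A - {v} = B - {v}"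
  shows "A = B"
proof -
  have "v \<in> A \<longleftrightarrow> v \<in> B"
    using assms by (metis Diff_empty Diff_insert0 card_Suc_Diff1 even_Suc)
  then show ?thesis using assms(5) by blast
qed

text \<open>Numbering the clique first makes \<open>{..<k}\<close> the detector set. The last two
  disjuncts are the two arcs of one edge, so the arc relation is symmetric for every
  \<open>f\<close>.\<close>

definition clique_trace_graph :: "nat \<Rightarrow> nat \<Rightarrow> (nat \<Rightarrow> nat set) \<Rightarrow> nat pair_pre_digraph" where
  "clique_trace_graph k n f =
     \<lparr>pverts = {..<n},
      parcs = {(u, v). u < n \<and> v < n \<and> u \<noteq> v \<and>
        (u < k \<and> v < k \<or> u < k \<and> k \<le> v \<and> u \<in> f v \<or> k \<le> u \<and> v < k \<and> v \<in> f u)}\<rparr>"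

lemma pverts_clique_trace_graph [simp]: "pverts (clique_trace_graph k n f) = {..<n}"
  by (simp add: clique_trace_graph_def)

lemma pair_graph_clique_trace_graph: "pair_graph (clique_trace_graph k n f)"
proof -
  let ?G = "clique_trace_graph k n f"
  have "parcs ?G \<subseteq> {..<n} \<times> {..<n}" by (auto simp: clique_trace_graph_def)
  then have "finite (parcs ?G)" by (rule finite_subset) simp
  then show ?thesis
    by unfold_locales (auto simp: clique_trace_graph_def symmetric_def sym_def)
qed

lemma open_nbhd_clique_trace_graph:
  assumes "u < n" and "k \<le> n" and "\<And>w. f w \<subseteq> {..<k}"
  shows "open_nbhd (clique_trace_graph k n f) u \<inter> {..<k} = (if u < k then {..<k} - {u} else f u)"
  using assms(1,2) assms(3)[of u] unfolding open_nbhd_def clique_trace_graph_def by auto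

lemma RED_LD_set_clique_trace_graph:
  assumes "k \<le> n" and "2 \<le> k" and "even k"
    and inj: "inj_on f {k..<n}"
    and sub: "\<And>w. f w \<subseteq> {..<k}"
    and ev: "\<And>w. w \<in> {k..<n} \<Longrightarrow> even (card (f w)) \<and> f w \<noteq> {} \<and> f w \<noteq> {..<k}"
  shows "RED_LD_set (clique_trace_graph k n f) {..<k}"
proof -
  let ?G = "clique_trace_graph k n f" and ?S = "{..<k}"
  have tr: "open_nbhd ?G u \<inter> ?S = (if u < k then ?S - {u} else f u)" if "u < n" for u
    using open_nbhd_clique_trace_graph[OF that assms(1) sub] .
  have tr': "open_nbhd ?G u \<inter> (?S - {v}) = (if u < k then ?S - {u} else f u) - {v}"
    if "u < n" for u v
    using tr[OF that] by blast
  have fin: "finite (f w)" for w using sub finite_subset by blast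
  have "LD_set ?G ?S"
    using assms(1) inj ev tr by (auto simp: LD_set_def inj_on_def)
  moreover have "LD_set ?G (?S - {v})" if v: "v < k" for v
  proof -
    \<comment> \<open>\<open>{}\<close> and, as \<open>k\<close> is even, \<open>?S\<close> have
      even size themselves, so the parity lemma compares a trace with them just as it compares two
      traces.\<close>
    have ne: "f w - {v} \<noteq> {}" if "w \<in> {k..<n}" for w
    proof
      assume "f w - {v} = {}"
      then have "f w = {}" using even_card_eq_if_Diff_eq[OF fin, of "{}" w v] ev[OF that] by auto
      then show False using ev[OF that] by blast
    qed
    have nev: "f w - {v} \<noteq> ?S - {v}" if "w \<in> {k..<n}" for w
      using even_card_eq_if_Diff_eq[OF fin, of ?S w v] ev[OF that] assms(3) by auto
    have neS: "?S - {v} \<noteq> {}"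
    proof
      assume "?S - {v} = {}"
      then have "card (?S - {v}) = 0" by simp
      then show False using v assms(2) by simp
    qed
    have inj': "u = w" if "u \<in> {k..<n}" "w \<in> {k..<n}" "f u - {v} = f w - {v}" for u w
      using even_card_eq_if_Diff_eq[OF fin fin _ _ that(3)] ev that(1,2) inj
      by (auto simp: inj_on_def)
    \<comment> \<open>The deleted \<open>v\<close> is the only clique vertex left to be located, and
      it sees all remaining detectors.\<close>
    have out: "u \<in> {k..<n} \<or> u = v" if "u \<in> {..<n} - (?S - {v})" for u
      using that by auto
    have trv: "open_nbhd ?G v \<inter> (?S - {v}) = ?S - {v}"
      using tr'[of v v] v assms(1) by simp
    have trf: "open_nbhd ?G u \<inter> (?S - {v}) = f u - {v}" if "u \<in> {k..<n}" for u
      using tr'[of u v] that by simp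
    show ?thesis
      unfolding LD_set_def pverts_clique_trace_graph
    proof (intro conjI ballI impI)
      show "?S - {v} \<subseteq> {..<n}" using assms(1) by auto
    next
      fix u w assume "w \<in> {..<n} - (?S - {v})"
      then show "open_nbhd ?G w \<inter> (?S - {v}) \<noteq> {}"
        using out[of w] ne neS trv trf by metis
    next
      fix u w assume "u \<in> {..<n} - (?S - {v})" "w \<in> {..<n} - (?S - {v})" "u \<noteq> w"
      then show "open_nbhd ?G w \<inter> (?S - {v}) \<noteq> open_nbhd ?G u \<inter> (?S - {v})"
        using out[of u] out[of w] nev inj' trv trf by metis
    qed
  qed
  ultimately show ?thesis by (simp add: RED_LD_set_def)
qed

theorem theorem4:
  fixes j k :: nat
  assumes "j > 0" and "k = 2 * j"
  shows "\<exists>G :: nat pair_pre_digraph.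
           pair_graph G \<and> card (pverts G) = 2 ^ (k - 1) + k - 2 \<and> RED_LD G = enat k"
proof -
  define n where "n = 2 ^ (k - 1) + k - 2"
  define E where "E = {B. B \<subseteq> {..<k} \<and> even (card B)} - {{}, {..<k}}"
  have k: "2 \<le> k" "even k" using assms by auto
  \<comment> \<open>This makes the subtraction of 2 in \<open>n\<close> exact. For
    \<open>k = 2\<close> it gives \<open>n = k\<close>: the graph is the bare clique.\<close>
  have "(2::nat) ^ 1 \<le> 2 ^ (k - 1)" using k by (intro power_increasing) auto
  then have n: "k \<le> n" "n - k = 2 ^ (k - 1) - 2" "n + 2 = 2 ^ (k - 1) + k"
    by (auto simp: n_def)
  have ne: "{..<k} \<noteq> {}" using k by (simp add: lessThan_empty_iff)
  \<comment> \<open>The two removed sets are distinct and both even, so exactly two are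
    lost.\<close>
  have "card E = card {B. B \<subseteq> {..<k} \<and> even (card B)} - card {{}, {..<k}}"
    unfolding E_def using k by (intro card_Diff_subset) auto
  also have "\<dots> = 2 ^ (k - 1) - 2"
    using card_even_subsets[of "{..<k}"] ne by simp
  finally have "card {k..<n} = card E" using n by simp
  moreover have "finite E" unfolding E_def by simp
  ultimately obtain g where g: "bij_betw g {k..<n} E"
    using finite_same_card_bij[of "{k..<n}" E] by auto
  \<comment> \<open>The default \<open>{}\<close> makes \<open>f w \<subseteq> {..<k}\<close> true
    for every \<open>w\<close>, not only for the outer vertices.\<close>
  define f where "f w = (if w \<in> {k..<n} then g w else {})" for w
  have f: "bij_betw f {k..<n} E"
    using g by (rule bij_betw_cong[THEN iffD1, rotated]) (simp add: f_def)
  have fE: "f w \<in> E" if "w \<in> {k..<n}" for w using f that bij_betwE by blast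
  have fsub: "f w \<subseteq> {..<k}" for w
    using fE[of w] by (cases "w \<in> {k..<n}") (auto simp: E_def f_def)
  let ?G = "clique_trace_graph k n f"
  have red: "RED_LD_set ?G {..<k}"
    using n(1) k bij_betw_imp_inj_on[OF f] fsub
    by (rule RED_LD_set_clique_trace_graph) (use fE in \<open>auto simp: E_def\<close>)
  have lower: "k \<le> card T" if T: "RED_LD_set ?G T" for T
  proof (rule ccontr)
    assume "\<not> k \<le> card T"
    \<comment> \<open>Strictness comes from the linear summand, which also covers
      \<open>card T = 0\<close>, where the exponent is truncated. The right side is exactly
      \<open>n + 2\<close>.\<close>
    then have "(2::nat) ^ (card T - 1) + card T < 2 ^ (k - 1) + k"
      by (intro add_le_less_mono power_increasing) auto
    moreover have "card (pverts ?G) + 2 \<le> 2 ^ (card T - 1) + card T"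
      using n(1) k T by (intro RED_LD_set_card_bound) (auto simp: lessThan_empty_iff)
    ultimately show False using n(3) by simp
  qed
  have "RED_LD ?G = enat k"
    unfolding RED_LD_def
  proof (rule antisym)
    show "(INF S\<in>{S. RED_LD_set ?G S}. enat (card S)) \<le> enat k"
      using red by (intro INF_lower2[of "{..<k}"]) auto
    show "enat k \<le> (INF S\<in>{S. RED_LD_set ?G S}. enat (card S))"
      using lower by (intro INF_greatest) auto
  qed
  then show ?thesis
    using pair_graph_clique_trace_graph[of k n f] n_def
    by (intro exI[of _ ?G]) simp
qed

end
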